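(* Let $m,N,k\ge1$ be integers and $t$ a real number. Let $A\in\mathbb{R}^{m\times N}$ satisfy the S-RIP of order $tk$ with constants $0<\theta_-<1<\theta_+<2$, where $$t\ge\max\left\{\frac{2}{\theta_-},\ \frac{2}{2-\theta_+}\right\}>2.$$ Let $\Delta$ be a decoder given, for every $x_0\in\mathbb{R}^N$, by a minimizer $$\Delta(|Ax_0|)\in\mathop{\mathrm{argmin}}_{x\in\mathbb{R}^N}\left\{\|x\|_1:\ |Ax|=|Ax_0|\right\}.$$ Then $(A,\Delta)$ has the $\ell_1$-norm phaseless instance optimality of order $k$ with constant $C=\frac{2C_0}{2-C_0}$, that is, for all $x_0\in\mathbb{R}^N$, $$\min\bigl\{\|x_0-\Delta(|Ax_0|)\|_1,\ \|x_0+\Delta(|Ax_0|)\|_1\bigr\}\le\frac{2C_0}{2-C_0}\,\sigma_k(x_0)_1,$$ where $$C_0=1+\sqrt{\frac{1+\delta}{(t-1)(1-\delta)}},\qquad \delta:=\max\{1-\theta_-,\theta_+-1\}\le 1-\frac{2}{t}.$$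
   Context: For $y\in\mathbb{R}^m$, $|y|$ denotes the vector of entrywise absolute values. A vector is $r$-sparse if it has at most $r$ nonzero entries. $\sigma_k(x)_1:=\min\{\|x-z\|_1: z\in\mathbb{R}^N \text{ is } k\text{-sparse}\}$. A decoder is a map $\Delta:\mathbb{R}^m\to\mathbb{R}^N$. For $A\in\mathbb{R}^{m\times N}$ and $I\subseteq[m]:=\{1,\dots,m\}$, $A_I$ is the submatrix of $A$ keeping only the rows with indices in $I$. $A$ has the Strong Restricted Isometry Property (S-RIP) of order $r$ with constants $\theta_-,\theta_+\in(0,2)$ if $$\theta_-\|x\|_2^2\le\min_{I\subseteq[m],\,|I|\ge m/2}\|A_Ix\|_2^2\le\max_{I\subseteq[m],\,|I|\ge m/2}\|A_Ix\|_2^2\le\theta_+\|x\|_2^2$$ for all $r$-sparse $x\in\mathbb{R}^N$. For non-integer $r$, order $r$ means order $\lceil r\rceil$. *)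

theory Defs
  imports "HOL-Analysis.Analysis" "HOL-Library.Extended_Real"
begin

definition l1_norm :: "real ^ 'n \<Rightarrow> real" where
  "l1_norm x = (\<Sum>i\<in>UNIV. \<bar>x $ i\<bar>)"

definition sparse :: "nat \<Rightarrow> real ^ 'n \<Rightarrow> bool" where
  "sparse r x \<longleftrightarrow> card {i. x $ i \<noteq> 0} \<le> r"

text \<open>The infimum below is attained; see \<open>best_approx_error_attained\<close>.\<close>

definition best_approx_error :: "nat \<Rightarrow> real ^ 'n \<Rightarrow> real" where
  "best_approx_error k x = (INF z\<in>{z. sparse k z}. l1_norm (x - z))"

lemma best_approx_error_attained:
  fixes x :: "real ^ 'n"
  shows "\<exists>z. sparse k z \<and> best_approx_error k x = l1_norm (x - z)
           \<and> (\<forall>w. sparse k w \<longrightarrow> l1_norm (x - z) \<le> l1_norm (x - w))"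
proof -
  define f where "f T = (\<Sum>i\<in>-T. \<bar>x $ i\<bar>)" for T :: "'n set"
  define S where "S = {T :: 'n set. card T \<le> k}"
  have "{} \<in> S" by (simp add: S_def)
  then have "finite S" "S \<noteq> {}" by auto
  then obtain T where T: "T \<in> S" "\<And>U. U \<in> S \<Longrightarrow> f T \<le> f U"
    by (metis arg_min_if_finite(1) arg_min_least)
  define z :: "real ^ 'n" where "z = (\<chi> i. if i \<in> T then x $ i else 0)"
  have "card {i. z $ i \<noteq> 0} \<le> card T"
    by (rule card_mono) (auto simp: z_def)
  with T(1) have z: "sparse k z"
    by (simp add: sparse_def S_def)
  have lz: "l1_norm (x - z) = f T"
    unfolding l1_norm_def f_def z_def
    by (rule sum.mono_neutral_cong_right) auto
  have min: "l1_norm (x - z) \<le> l1_norm (x - w)" if "sparse k w" for w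
  proof -
    define U where "U = {i. w $ i \<noteq> 0}"
    have "f T \<le> f U"
      using that T(2) by (simp add: S_def U_def sparse_def)
    also have "f U = (\<Sum>i\<in>-U. \<bar>(x - w) $ i\<bar>)"
      unfolding f_def U_def by (rule sum.cong) auto
    also have "\<dots> \<le> l1_norm (x - w)"
      unfolding l1_norm_def by (rule sum_mono2) auto
    finally show ?thesis by (simp add: lz)
  qed
  have "best_approx_error k x = l1_norm (x - z)"
    unfolding best_approx_error_def
    by (rule cInf_eq_minimum) (use z min in auto)
  with z min show ?thesis by blast
qed

text \<open>The rows of the submatrix \<open>A\<^sub>I\<close> are the rows of \<open>A\<close> with index in \<open>I\<close>, so \<open>A\<^sub>I x\<close> is the
  vector \<open>((A x)\<^sub>i)\<close> indexed by \<open>i \<in> I\<close>; the following is its Euclidean norm.\<close>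

definition submatrix_norm :: "real ^ 'n ^ 'm \<Rightarrow> 'm set \<Rightarrow> real ^ 'n \<Rightarrow> real" where
  "submatrix_norm A I x = L2_set (\<lambda>i. (A *v x) $ i) I"

text \<open>The order \<open>r\<close> is real; a non-integer order is rounded up.\<close>

definition srip :: "real ^ 'n ^ 'm \<Rightarrow> real \<Rightarrow> real \<Rightarrow> real \<Rightarrow> bool" where
  "srip A r \<theta>m \<theta>p \<longleftrightarrow>
     \<theta>m \<in> {0<..<2} \<and> \<theta>p \<in> {0<..<2} \<and>
     (\<forall>x. sparse (nat \<lceil>r\<rceil>) x \<longrightarrow>
        (let \<I> = {I :: 'm set. real (card I) \<ge> real CARD('m) / 2} in
           \<theta>m * (norm x)\<^sup>2 \<le> (MIN I\<in>\<I>. (submatrix_norm A I x)\<^sup>2) \<and>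
           (MIN I\<in>\<I>. (submatrix_norm A I x)\<^sup>2) \<le> (MAX I\<in>\<I>. (submatrix_norm A I x)\<^sup>2) \<and>
           (MAX I\<in>\<I>. (submatrix_norm A I x)\<^sup>2) \<le> \<theta>p * (norm x)\<^sup>2))"

text \<open>On \<open>real ^ 'm\<close> the absolute value \<open>\<bar>y\<bar>\<close> is taken entrywise. Minimizers need not be unique:
  the decoder returns any one of them.\<close>

definition phaseless_l1_decoder :: "real ^ 'n ^ 'm \<Rightarrow> (real ^ 'm \<Rightarrow> real ^ 'n) \<Rightarrow> bool" where
  "phaseless_l1_decoder A \<Delta> \<longleftrightarrow>
     (\<forall>x\<^sub>0. is_arg_min l1_norm (\<lambda>x. \<bar>A *v x\<bar> = \<bar>A *v x\<^sub>0\<bar>) (\<Delta> \<bar>A *v x\<^sub>0\<bar>))"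

text \<open>The constant is an extended real so that it may be infinite. As \<open>\<infinity> * 0 = 0\<close>, the constant
  \<open>\<infinity>\<close> means exact recovery, up to sign, of all \<open>k\<close>-sparse vectors.\<close>

definition phaseless_instance_optimal ::
  "real ^ 'n ^ 'm \<Rightarrow> (real ^ 'm \<Rightarrow> real ^ 'n) \<Rightarrow> nat \<Rightarrow> ereal \<Rightarrow> bool" where
  "phaseless_instance_optimal A \<Delta> k C \<longleftrightarrow>
     (\<forall>x\<^sub>0. ereal (min (l1_norm (x\<^sub>0 - \<Delta> \<bar>A *v x\<^sub>0\<bar>)) (l1_norm (x\<^sub>0 + \<Delta> \<bar>A *v x\<^sub>0\<bar>)))
            \<le> C * ereal (best_approx_error k x\<^sub>0))"

end

theory Submission
  imports Defs
begin

text \<open>A minimizer \<open>y\<close> agrees in its measurements with \<open>x\<^sub>0\<close> or with \<open>- x\<^sub>0\<close> on a set \<open>I\<close> of at least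
  half of the rows, so \<open>h = y \<mp> x\<^sub>0\<close> lies in the kernel of \<open>A\<^sub>I\<close>, which satisfies the restricted
  isometry property with constant \<open>\<delta>\<close>. Cutting the complement of a set \<open>T\<close> of \<open>k\<close> indices into
  blocks of size \<open>s = \<lceil>t k\<rceil> - k\<close> in order of decreasing \<open>\<bar>h\<^sub>i\<bar>\<close> gives
  \<open>\<parallel>h\<^sub>T\<parallel>\<^sub>1 < \<rho> \<parallel>h\<^sub>-\<^sub>T\<parallel>\<^sub>1\<close> for \<open>h \<noteq> 0\<close>, where \<open>\<rho> = C\<^sub>0 - 1 \<le> 1\<close>. Minimality of \<open>\<parallel>y\<parallel>\<^sub>1\<close> gives
  \<open>\<parallel>h\<^sub>-\<^sub>T\<parallel>\<^sub>1 \<le> \<parallel>h\<^sub>T\<parallel>\<^sub>1 + 2 \<sigma>\<^sub>k(x\<^sub>0)\<close>, and the two combine to the claim. The strictness yields exact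
  recovery of sparse vectors in the boundary case \<open>\<rho> = 1\<close>, where the constant is infinite.\<close>

section \<open>Blocks of entries in decreasing order of magnitude\<close>

text \<open>Greedy choice: a maximizer of \<open>f\<close> on \<open>U - V\<close> may be added to
  \<open>V\<close> without losing dominance over the rest. The implication
  \<open>V \<noteq> U \<longrightarrow> card V = s\<close> allows \<open>U\<close> to have fewer
  than \<open>s\<close> elements; the growth then stops at \<open>V = U\<close>.\<close>

lemma exists_top_subset:
  fixes f :: "'a \<Rightarrow> 'b::linorder"
  assumes "finite U"
  shows "\<exists>V\<subseteq>U. card V \<le> s \<and> (V \<noteq> U \<longrightarrow> card V = s) \<and> (\<forall>i\<in>V. \<forall>j\<in>U - V. f j \<le> f i)"
proof (induction s)
  case 0
  show ?case by (rule exI[of _ "{}"]) auto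
next
  case (Suc s)
  then obtain V where V: "V \<subseteq> U" "card V \<le> s" "V \<noteq> U \<longrightarrow> card V = s"
      "\<forall>i\<in>V. \<forall>j\<in>U - V. f j \<le> f i" by blast
  show ?case
  proof (cases "V = U")
    case True
    then show ?thesis using V by (intro exI[of _ V]) auto
  next
    case False
    have fin: "finite V" "finite (U - V)" using V(1) assms by (auto intro: finite_subset)
    have "Max (f ` (U - V)) \<in> f ` (U - V)"
      using False V(1) fin by (intro Max_in) auto
    then obtain a where a: "a \<in> U - V" "f a = Max (f ` (U - V))" by auto
    have "\<forall>j\<in>U - V. f j \<le> f a" using a(2) fin by auto
    then show ?thesis using V a(1) fin False by (intro exI[of _ "insert a V"]) auto
  qed
qed

definition restrict_vec :: "'n set \<Rightarrow> real ^ 'n \<Rightarrow> real ^ 'n" where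
  "restrict_vec U x = (\<chi> i. if i \<in> U then x $ i else 0)"

lemma restrict_vec_Un_disjoint:
  assumes "U \<inter> V = {}"
  shows "restrict_vec (U \<union> V) x = restrict_vec U x + restrict_vec V x"
  using assms by (auto simp: restrict_vec_def vec_eq_iff)

lemma restrict_vec_UNIV [simp]: "restrict_vec UNIV x = x"
  by (simp add: restrict_vec_def vec_eq_iff)

lemma norm_restrict_vec: "norm (restrict_vec U x) = L2_set (\<lambda>i. x $ i) U"
proof -
  have "(\<Sum>i\<in>UNIV. (norm (restrict_vec U x $ i))\<^sup>2) = (\<Sum>i\<in>U. (x $ i)\<^sup>2)"
    by (rule sum.mono_neutral_cong_right) (auto simp: restrict_vec_def)
  then show ?thesis by (simp add: norm_vec_def L2_set_def)
qed

lemma sparse_restrict_vec: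
  assumes "card U \<le> s"
  shows "sparse s (restrict_vec U x)"
proof -
  have "card {i. restrict_vec U x $ i \<noteq> 0} \<le> card U"
    by (rule card_mono) (auto simp: restrict_vec_def)
  with assms show ?thesis by (simp add: sparse_def)
qed

text \<open>Peel off the \<open>s\<close> largest entries of \<open>U\<close> repeatedly. A block
  with entries at most \<open>M\<close> has Euclidean norm at most \<open>sqrt s * M\<close>, and
  each later block is controlled by the average of the block before it. Multiplied by
  \<open>sqrt s\<close>, that average is the l1 mass of the earlier block over
  \<open>sqrt s\<close>, so these terms sum to at most the mass of \<open>U\<close> over
  \<open>sqrt s\<close>.\<close>

lemma block_decomposition_bound:
  fixes h :: "real ^ 'n" and p :: "real ^ 'n \<Rightarrow> real"
  assumes triangle: "\<And>x y. p (x + y) \<le> p x + p y"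
    and bound: "\<And>x. sparse s x \<Longrightarrow> p x \<le> B * norm x"
    and "B \<ge> 0" "s > 0" "M \<ge> 0"
    and "\<And>i. i \<in> U \<Longrightarrow> \<bar>h $ i\<bar> \<le> M"
  shows "p (restrict_vec U h) \<le> B * (sqrt s * M + (\<Sum>i\<in>U. \<bar>h $ i\<bar>) / sqrt s)"
  using assms(5,6)
proof (induction "card U" arbitrary: U M rule: less_induct)
  case less
  obtain V where V: "V \<subseteq> U" "card V \<le> s" "V \<noteq> U \<longrightarrow> card V = s"
      "\<forall>i\<in>V. \<forall>j\<in>U - V. \<bar>h $ j\<bar> \<le> \<bar>h $ i\<bar>"
    using exists_top_subset[of U s "\<lambda>i. \<bar>h $ i\<bar>"] by auto
  have "norm (restrict_vec V h) \<le> sqrt (s * M\<^sup>2)"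
    unfolding norm_restrict_vec L2_set_def
  proof (rule real_sqrt_le_mono)
    have "(\<Sum>i\<in>V. (h $ i)\<^sup>2) \<le> (\<Sum>i\<in>V. M\<^sup>2)"
      using less.prems V(1) by (intro sum_mono) (metis abs_le_square_iff abs_of_nonneg subsetD)
    also have "\<dots> \<le> s * M\<^sup>2" using V(2) by (simp add: mult_right_mono)
    finally show "(\<Sum>i\<in>V. (h $ i)\<^sup>2) \<le> s * M\<^sup>2" .
  qed
  also have "\<dots> = sqrt s * M" using less.prems(1) by (simp add: real_sqrt_mult)
  finally have "B * norm (restrict_vec V h) \<le> B * (sqrt s * M)"
    using \<open>B \<ge> 0\<close> by (rule mult_left_mono)
  with bound[OF sparse_restrict_vec[OF V(2)], of h]
  have pV: "p (restrict_vec V h) \<le> B * (sqrt s * M)" by linarith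
  show ?case
  proof (cases "V = U")
    case True
    \<comment> \<open>On the last block the \<open>M\<close> term suffices, and the l1 term is only
      added as slack.\<close>
    have "0 \<le> B * ((\<Sum>i\<in>U. \<bar>h $ i\<bar>) / sqrt s)"
      using \<open>B \<ge> 0\<close> by (simp add: sum_nonneg)
    then show ?thesis using pV True by (simp add: distrib_left)
  next
    case False
    then have cV: "card V = s" using V(3) by simp
    \<comment> \<open>The average over the full block \<open>V\<close> dominates every remaining
      entry and takes the place of \<open>M\<close> in the induction hypothesis.\<close>
    define M' where "M' = (\<Sum>i\<in>V. \<bar>h $ i\<bar>) / s"
    have "card (U - V) < card U"
      using V(1) \<open>s > 0\<close> cV card_mono[OF _ V(1)] by (simp add: card_Diff_subset)
    moreover have "M' \<ge> 0" by (simp add: M'_def sum_nonneg)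
    moreover have "\<bar>h $ j\<bar> \<le> M'" if "j \<in> U - V" for j
    proof -
      have "(\<Sum>i\<in>V. \<bar>h $ j\<bar>) \<le> (\<Sum>i\<in>V. \<bar>h $ i\<bar>)" using V(4) that by (intro sum_mono) auto
      then show ?thesis using \<open>s > 0\<close> cV by (simp add: M'_def field_simps)
    qed
    ultimately have "p (restrict_vec (U - V) h)
        \<le> B * (sqrt s * M' + (\<Sum>i\<in>U - V. \<bar>h $ i\<bar>) / sqrt s)"
      by (rule less.hyps)
    also have "sqrt s * M' = (\<Sum>i\<in>V. \<bar>h $ i\<bar>) / sqrt s"
      using \<open>s > 0\<close> by (simp add: M'_def field_simps)
    also have "\<dots> + (\<Sum>i\<in>U - V. \<bar>h $ i\<bar>) / sqrt s = (\<Sum>i\<in>U. \<bar>h $ i\<bar>) / sqrt s"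
      using sum.subset_diff[OF V(1), of "\<lambda>i. \<bar>h $ i\<bar>"] by (simp add: add_divide_distrib)
    finally have "p (restrict_vec (U - V) h) \<le> B * ((\<Sum>i\<in>U. \<bar>h $ i\<bar>) / sqrt s)" .
    moreover have "p (restrict_vec U h) \<le> p (restrict_vec V h) + p (restrict_vec (U - V) h)"
      using triangle[of "restrict_vec V h" "restrict_vec (U - V) h"]
        restrict_vec_Un_disjoint[of V "U - V" h] V(1) by (simp add: Un_absorb1)
    ultimately show ?thesis using pV by (simp add: distrib_left)
  qed
qed

section \<open>Null space property from restricted isometry bounds\<close>

lemma submatrix_norm_add:
  "submatrix_norm A I (x + y) \<le> submatrix_norm A I x + submatrix_norm A I y"
  unfolding submatrix_norm_def
  using L2_set_triangle_ineq[of "\<lambda>i. (A *v x) $ i" "\<lambda>i. (A *v y) $ i" I]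
  by (simp add: matrix_vector_right_distrib L2_set_def)

text \<open>With \<open>V\<close> the \<open>s\<close> largest entries off \<open>T\<close> and
  \<open>U\<close> the rest, the kernel condition makes the pieces of \<open>h\<close> on
  \<open>T \<union> V\<close> and on \<open>U\<close> equally long under the submatrix. The first is
  bounded below by \<open>lower\<close>, the second above by the block estimate; Cauchy-Schwarz on
  \<open>T\<close> returns to l1.\<close>

lemma strict_null_space_property:
  fixes A :: "real ^ 'n ^ 'm" and h :: "real ^ 'n"
  assumes lower: "\<And>x. sparse (k + s) x \<Longrightarrow> a * norm x \<le> submatrix_norm A I x"
    and upper: "\<And>x. sparse s x \<Longrightarrow> submatrix_norm A I x \<le> b * norm x"
    and "a > 0" "b \<ge> 0" "s > 0" "k > 0"
    and kernel: "\<And>i. i \<in> I \<Longrightarrow> (A *v h) $ i = 0"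
    and "h \<noteq> 0" "card T \<le> k"
  shows "a * sqrt s * (\<Sum>i\<in>T. \<bar>h $ i\<bar>) < b * sqrt k * (\<Sum>i\<in>-T. \<bar>h $ i\<bar>)"
proof -
  obtain V where V: "V \<subseteq> -T" "card V \<le> s" "V \<noteq> -T \<longrightarrow> card V = s"
      "\<forall>i\<in>V. \<forall>j\<in>-T - V. \<bar>h $ j\<bar> \<le> \<bar>h $ i\<bar>"
    using exists_top_subset[of "-T" s "\<lambda>i. \<bar>h $ i\<bar>"] by auto
  define U where "U = -T - V"
  have "T \<union> V \<union> U = UNIV" "(T \<union> V) \<inter> U = {}" by (auto simp: U_def)
  then have split: "restrict_vec (T \<union> V) h + restrict_vec U h = h"
    using restrict_vec_Un_disjoint[of "T \<union> V" U h] by simp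
  have sp: "sparse (k + s) (restrict_vec (T \<union> V) h)"
    using card_Un_le[of T V] V(2) \<open>card T \<le> k\<close> by (intro sparse_restrict_vec) simp
  have pU: "submatrix_norm A I (restrict_vec (T \<union> V) h) = submatrix_norm A I (restrict_vec U h)"
  proof -
    have "(A *v restrict_vec (T \<union> V) h) $ i = - (A *v restrict_vec U h) $ i" if "i \<in> I" for i
      using kernel[OF that] split
      by (metis add_eq_0_iff2 matrix_vector_right_distrib vector_add_component)
    then show ?thesis by (simp add: submatrix_norm_def L2_set_def)
  qed
  have tail: "submatrix_norm A I (restrict_vec U h) \<le> b * ((\<Sum>i\<in>-T. \<bar>h $ i\<bar>) / sqrt s)"
  proof (cases "V = -T")
    case True
    then have "restrict_vec U h = 0" by (simp add: U_def restrict_vec_def vec_eq_iff)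
    then show ?thesis using \<open>b \<ge> 0\<close> by (simp add: submatrix_norm_def L2_set_def sum_nonneg)
  next
    case False
    then have cV: "card V = s" using V(3) by simp
    \<comment> \<open>Starting the block estimate from the average over \<open>V\<close> turns its
      leading term into the mass of \<open>V\<close> over \<open>sqrt s\<close>, so \<open>V\<close>
      and \<open>U\<close> together give the whole mass off \<open>T\<close>.\<close>
    define M where "M = (\<Sum>i\<in>V. \<bar>h $ i\<bar>) / s"
    have "\<bar>h $ j\<bar> \<le> M" if "j \<in> U" for j
    proof -
      have "(\<Sum>i\<in>V. \<bar>h $ j\<bar>) \<le> (\<Sum>i\<in>V. \<bar>h $ i\<bar>)"
        using V(4) that by (intro sum_mono) (auto simp: U_def)
      then show ?thesis using \<open>s > 0\<close> cV by (simp add: M_def field_simps)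
    qed
    moreover have "M \<ge> 0" by (simp add: M_def sum_nonneg)
    ultimately have "submatrix_norm A I (restrict_vec U h)
        \<le> b * (sqrt s * M + (\<Sum>i\<in>U. \<bar>h $ i\<bar>) / sqrt s)"
      using upper \<open>b \<ge> 0\<close> \<open>s > 0\<close> by (intro block_decomposition_bound submatrix_norm_add)
    also have "sqrt s * M = (\<Sum>i\<in>V. \<bar>h $ i\<bar>) / sqrt s"
      using \<open>s > 0\<close> by (simp add: M_def field_simps)
    also have "\<dots> + (\<Sum>i\<in>U. \<bar>h $ i\<bar>) / sqrt s = (\<Sum>i\<in>-T. \<bar>h $ i\<bar>) / sqrt s"
      using sum.subset_diff[OF V(1), of "\<lambda>i. \<bar>h $ i\<bar>"] by (simp add: U_def add_divide_distrib)
    finally show ?thesis .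
  qed
  have upper_TV: "a * norm (restrict_vec (T \<union> V) h) \<le> b * ((\<Sum>i\<in>-T. \<bar>h $ i\<bar>) / sqrt s)"
    using lower[OF sp] pU tail by linarith
  \<comment> \<open>This is the source of strictness. If the largest entries off \<open>T\<close>
    vanished, \<open>h\<close> would be supported on \<open>T\<close>, and \<open>upper_TV\<close>
    would force \<open>h = 0\<close>.\<close>
  have "\<exists>i\<in>V. h $ i \<noteq> 0"
  proof (rule ccontr)
    assume "\<not> ?thesis"
    then have V0: "\<And>i. i \<in> V \<Longrightarrow> h $ i = 0" by blast
    have out: "h $ j = 0" if "j \<in> -T" for j
    proof (cases "j \<in> V")
      case False
      then have "V \<noteq> {}" using V(3) that \<open>s > 0\<close> by auto
      then show ?thesis using V(4) V0 that False by force
    qed (rule V0)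
    then have "restrict_vec (T \<union> V) h = h"
      by (auto simp: restrict_vec_def vec_eq_iff)
    then show False using upper_TV out \<open>a > 0\<close> \<open>h \<noteq> 0\<close> by (simp add: mult_le_0_iff)
  qed
  then obtain v where v: "v \<in> V" "h $ v \<noteq> 0" by blast
  have "(\<Sum>i\<in>T. \<bar>h $ i\<bar>) \<le> sqrt k * L2_set (\<lambda>i. h $ i) T"
  proof -
    have "(\<Sum>i\<in>T. \<bar>h $ i\<bar>) \<le> L2_set (\<lambda>i. h $ i) T * L2_set (\<lambda>i. 1) T"
      using L2_set_mult_ineq[of "\<lambda>i. h $ i" "\<lambda>i. 1" T] by simp
    also have "\<dots> \<le> L2_set (\<lambda>i. h $ i) T * sqrt k"
      using \<open>card T \<le> k\<close> by (intro mult_left_mono) (simp_all add: L2_set_def sum_nonneg)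
    finally show ?thesis by (simp only: mult.commute)
  qed
  \<comment> \<open>The nonzero entry at \<open>v\<close> is counted on the right but not on the
    left, because \<open>v\<close> lies outside \<open>T\<close>.\<close>
  moreover have strict: "L2_set (\<lambda>i. h $ i) T < norm (restrict_vec (T \<union> V) h)"
    unfolding norm_restrict_vec L2_set_def
    using v V(1) by (intro real_sqrt_less_mono sum_strict_mono2[of _ _ v]) auto
  ultimately have "(\<Sum>i\<in>T. \<bar>h $ i\<bar>) < sqrt k * norm (restrict_vec (T \<union> V) h)"
    using \<open>k > 0\<close> by (meson le_less_trans mult_strict_left_mono of_nat_0_less_iff real_sqrt_gt_zero)
  then have "a * sqrt s * (\<Sum>i\<in>T. \<bar>h $ i\<bar>)
      < a * sqrt s * (sqrt k * norm (restrict_vec (T \<union> V) h))"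
    using \<open>a > 0\<close> \<open>s > 0\<close> by (intro mult_strict_left_mono) auto
  also have "\<dots> = sqrt s * sqrt k * (a * norm (restrict_vec (T \<union> V) h))" by simp
  also have "\<dots> \<le> sqrt s * sqrt k * (b * ((\<Sum>i\<in>-T. \<bar>h $ i\<bar>) / sqrt s))"
    using upper_TV by (intro mult_left_mono) auto
  also have "\<dots> = b * sqrt k * (\<Sum>i\<in>-T. \<bar>h $ i\<bar>)" using \<open>s > 0\<close> by simp
  finally show ?thesis .
qed

section \<open>Error bounds from l1 minimality\<close>

lemma l1_norm_split: "l1_norm x = (\<Sum>i\<in>T. \<bar>x $ i\<bar>) + (\<Sum>i\<in>-T. \<bar>x $ i\<bar>)"
  unfolding l1_norm_def
  using sum.subset_diff[of T UNIV "\<lambda>i. \<bar>x $ i\<bar>"] by (simp add: Compl_eq_Diff_UNIV)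

text \<open>The triangle inequality is used through \<open>x\<close> on \<open>T\<close> and through
  \<open>y - x\<close> off \<open>T\<close>; in the sum, the terms in \<open>y\<close> combine to
  \<open>l1_norm y\<close>, which is at most \<open>l1_norm x\<close>.\<close>

lemma l1_cone_bound:
  assumes "l1_norm y \<le> l1_norm x"
  shows "(\<Sum>i\<in>-T. \<bar>(y - x) $ i\<bar>) \<le> (\<Sum>i\<in>T. \<bar>(y - x) $ i\<bar>) + 2 * (\<Sum>i\<in>-T. \<bar>x $ i\<bar>)"
proof -
  have "(\<Sum>i\<in>T. \<bar>x $ i\<bar>) \<le> (\<Sum>i\<in>T. \<bar>(y - x) $ i\<bar> + \<bar>y $ i\<bar>)"
    by (intro sum_mono) auto
  moreover have "(\<Sum>i\<in>-T. \<bar>(y - x) $ i\<bar>) \<le> (\<Sum>i\<in>-T. \<bar>x $ i\<bar> + \<bar>y $ i\<bar>)"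
    by (intro sum_mono) auto
  ultimately show ?thesis
    using assms l1_norm_split[of x T] l1_norm_split[of y T] by (simp add: sum.distrib)
qed

text \<open>Eliminates the mass on \<open>T\<close> between the cone bound and the null space
  property. Leaving \<open>1 - \<rho>\<close> undivided admits \<open>\<rho> = 1\<close>, where the
  first claim says nothing about the error and the second takes over. The property is asked only for
  \<open>y \<noteq> x\<close>, since a strict inequality fails for the zero vector.\<close>

lemma l1_error_bound:
  assumes le: "l1_norm y \<le> l1_norm x" and "0 \<le> \<rho>" "\<rho> \<le> 1"
    and nsp: "y \<noteq> x \<Longrightarrow> (\<Sum>i\<in>T. \<bar>(y - x) $ i\<bar>) < \<rho> * (\<Sum>i\<in>-T. \<bar>(y - x) $ i\<bar>)"
  shows "(1 - \<rho>) * l1_norm (y - x) \<le> 2 * (1 + \<rho>) * (\<Sum>i\<in>-T. \<bar>x $ i\<bar>)"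
    and "(\<Sum>i\<in>-T. \<bar>x $ i\<bar>) = 0 \<Longrightarrow> y = x"
proof -
  define H S \<sigma> where "H = (\<Sum>i\<in>T. \<bar>(y - x) $ i\<bar>)" and "S = (\<Sum>i\<in>-T. \<bar>(y - x) $ i\<bar>)"
    and "\<sigma> = (\<Sum>i\<in>-T. \<bar>x $ i\<bar>)"
  note defs = H_def S_def \<sigma>_def
  have pos: "H \<ge> 0" "S \<ge> 0" "\<sigma> \<ge> 0" by (simp_all add: defs sum_nonneg)
  have cone: "S \<le> H + 2 * \<sigma>" using l1_cone_bound[OF le, of T] by (simp add: defs)
  have norm: "l1_norm (y - x) = H + S" using l1_norm_split[of "y - x" T] by (simp add: defs)
  have H: "H < \<rho> * S" if "y \<noteq> x" using nsp[OF that] by (simp add: defs)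
  have "y = x" if "\<sigma> = 0"
  proof (rule ccontr)
    assume "y \<noteq> x"
    \<comment> \<open>With \<open>\<sigma> = 0\<close> this closes the cycle
      \<open>S \<le> H < \<rho> * S \<le> S\<close>.\<close>
    moreover have "\<rho> * S \<le> 1 * S" using \<open>\<rho> \<le> 1\<close> pos by (intro mult_right_mono)
    ultimately show False using H cone that by linarith
  qed
  then show "(\<Sum>i\<in>-T. \<bar>x $ i\<bar>) = 0 \<Longrightarrow> y = x" by (simp add: defs)
  have "(1 - \<rho>) * (H + S) \<le> 2 * (1 + \<rho>) * \<sigma>" if "y \<noteq> x"
  proof -
    have "(1 - \<rho>) * (H + S) \<le> (1 - \<rho>) * ((1 + \<rho>) * S)"
      using H[OF that] \<open>\<rho> \<le> 1\<close> by (intro mult_left_mono) (auto simp: algebra_simps)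
    also have "\<dots> = (1 + \<rho>) * (S - \<rho> * S)" by (simp add: algebra_simps)
    also have "\<dots> \<le> (1 + \<rho>) * (2 * \<sigma>)"
      using H[OF that] cone \<open>0 \<le> \<rho>\<close> by (intro mult_left_mono) auto
    finally show ?thesis by (simp add: algebra_simps)
  qed
  moreover have "(1 - \<rho>) * (H + S) \<le> 2 * (1 + \<rho>) * \<sigma>" if "y = x"
    using that \<open>0 \<le> \<rho>\<close> pos(3) by (simp add: H_def S_def)
  ultimately show "(1 - \<rho>) * l1_norm (y - x) \<le> 2 * (1 + \<rho>) * (\<Sum>i\<in>-T. \<bar>x $ i\<bar>)"
    unfolding norm \<sigma>_def[symmetric] by blast
qed

section \<open>From the S-RIP to the constant of the null space property\<close>

lemma srip_bounds:
  fixes A :: "real ^ 'n ^ 'm"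
  assumes "srip A r \<theta>m \<theta>p" "sparse (nat \<lceil>r\<rceil>) x" "real (card I) \<ge> real CARD('m) / 2"
  shows "sqrt \<theta>m * norm x \<le> submatrix_norm A I x" "submatrix_norm A I x \<le> sqrt \<theta>p * norm x"
proof -
  let ?f = "\<lambda>I. (submatrix_norm A I x)\<^sup>2"
  let ?\<I> = "{I :: 'm set. real (card I) \<ge> real CARD('m) / 2}"
  have "I \<in> ?\<I>" using assms(3) by simp
  then have "(MIN I\<in>?\<I>. ?f I) \<le> ?f I" "?f I \<le> (MAX I\<in>?\<I>. ?f I)" by (auto intro: Min_le Max_ge)
  moreover have "\<theta>m * (norm x)\<^sup>2 \<le> (MIN I\<in>?\<I>. ?f I)" "(MAX I\<in>?\<I>. ?f I) \<le> \<theta>p * (norm x)\<^sup>2"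
    using assms(1,2) unfolding srip_def Let_def by blast+
  ultimately have le: "\<theta>m * (norm x)\<^sup>2 \<le> ?f I" "?f I \<le> \<theta>p * (norm x)\<^sup>2" by linarith+
  have nonneg: "submatrix_norm A I x \<ge> 0" by (simp add: submatrix_norm_def)
  show "sqrt \<theta>m * norm x \<le> submatrix_norm A I x"
    using real_sqrt_le_mono[OF le(1)] nonneg by (simp add: real_sqrt_mult)
  show "submatrix_norm A I x \<le> sqrt \<theta>p * norm x"
    using real_sqrt_le_mono[OF le(2)] nonneg by (simp add: real_sqrt_mult)
qed

text \<open>The weakened constants \<open>a\<close> and \<open>b\<close> leave room for the
  symmetric choice \<open>1 - \<delta>\<close> and \<open>1 + \<delta>\<close>. The factor
  \<open>t - 1\<close> arises from \<open>s \<ge> (t - 1) * k\<close>, after which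
  \<open>sqrt k\<close> cancels.\<close>

lemma srip_strict_null_space_property:
  fixes A :: "real ^ 'n ^ 'm"
  assumes srip: "srip A (t * real k) \<theta>m \<theta>p"
    and "t > 1" "k \<ge> 1" "0 < a" "a \<le> \<theta>m" "\<theta>p \<le> b"
    and I: "real (card I) \<ge> real CARD('m) / 2"
    and "\<And>i. i \<in> I \<Longrightarrow> (A *v h) $ i = 0"
    and "h \<noteq> 0" "card T \<le> k"
  shows "(\<Sum>i\<in>T. \<bar>h $ i\<bar>) < sqrt (b / ((t - 1) * a)) * (\<Sum>i\<in>-T. \<bar>h $ i\<bar>)"
proof -
  \<comment> \<open>The block size is chosen so that \<open>k + s\<close> is exactly the rounded
    order of the S-RIP; \<open>t > 1\<close> keeps the natural subtraction from truncating.\<close>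
  define s where "s = nat \<lceil>t * real k\<rceil> - k"
  have tk: "(t - 1) * k > 0" using \<open>t > 1\<close> \<open>k \<ge> 1\<close> by simp
  have "real (nat \<lceil>t * real k\<rceil>) \<ge> t * k" by linarith
  moreover have "t * k > k" using tk by (simp add: algebra_simps)
  ultimately have ks: "k + s = nat \<lceil>t * real k\<rceil>" unfolding s_def by linarith
  have "real k + real s \<ge> t * k" unfolding of_nat_add[symmetric] ks by linarith
  then have s: "real s \<ge> (t - 1) * k" by (simp add: algebra_simps)
  then have "s > 0" using tk by linarith
  have "\<theta>p > 0" using srip by (simp add: srip_def)
  then have "b > 0" using \<open>\<theta>p \<le> b\<close> by linarith
  have lower: "sqrt a * norm x \<le> submatrix_norm A I x" if "sparse (k + s) x" for x
    using srip_bounds(1)[OF srip _ I] that ks \<open>a \<le> \<theta>m\<close>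
    by (smt (verit) mult_right_mono norm_ge_zero real_sqrt_le_mono)
  have upper: "submatrix_norm A I x \<le> sqrt b * norm x" if "sparse s x" for x
  proof -
    have "sparse (nat \<lceil>t * real k\<rceil>) x" using that ks by (simp add: sparse_def)
    then show ?thesis using srip_bounds(2)[OF srip _ I] \<open>\<theta>p \<le> b\<close>
      by (smt (verit) mult_right_mono norm_ge_zero real_sqrt_le_mono)
  qed
  let ?H = "\<Sum>i\<in>T. \<bar>h $ i\<bar>" and ?S = "\<Sum>i\<in>-T. \<bar>h $ i\<bar>"
  have "sqrt a * sqrt ((t - 1) * k) * ?H \<le> sqrt a * sqrt s * ?H"
    using s \<open>a > 0\<close> by (intro mult_right_mono mult_left_mono) (auto simp: sum_nonneg)
  also have "\<dots> < sqrt b * sqrt k * ?S"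
    using lower upper \<open>a > 0\<close> \<open>b > 0\<close> \<open>s > 0\<close> assms(3,8-)
    by (intro strict_null_space_property) auto
  finally have "sqrt k * (sqrt ((t - 1) * a) * ?H) < sqrt k * (sqrt b * ?S)"
    by (simp add: real_sqrt_mult mult_ac)
  then have "sqrt ((t - 1) * a) * ?H < sqrt b * ?S" using \<open>k \<ge> 1\<close> by simp
  moreover have "sqrt ((t - 1) * a) > 0" using \<open>t > 1\<close> \<open>a > 0\<close> by simp
  ultimately have "?H < sqrt b * ?S / sqrt ((t - 1) * a)"
    by (simp only: pos_less_divide_eq mult.commute)
  then show ?thesis by (simp only: real_sqrt_divide times_divide_eq_left)
qed

section \<open>Sign ambiguity and instance optimality\<close>

text \<open>Pigeonhole: the coordinates where \<open>u\<close> and \<open>v\<close> agree and their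
  complement, where they are opposite, cannot both be smaller than half.\<close>

lemma half_agree_or_opposite:
  fixes u v :: "real ^ 'm"
  assumes "\<bar>u\<bar> = \<bar>v\<bar>"
  obtains I where "real (card I) \<ge> real CARD('m) / 2" "\<And>i. i \<in> I \<Longrightarrow> u $ i = v $ i"
    | I where "real (card I) \<ge> real CARD('m) / 2" "\<And>i. i \<in> I \<Longrightarrow> u $ i = - v $ i"
proof -
  define I where "I = {i. u $ i = v $ i}"
  have "\<bar>u $ i\<bar> = \<bar>v $ i\<bar>" for i using assms by (simp add: abs_vec_def vec_eq_iff)
  then have opp: "u $ i = - v $ i" if "i \<in> -I" for i
    using that by (auto simp: I_def abs_eq_iff)
  have "card I + card (-I) = CARD('m)"
    using card_Un_disjoint[of I "-I"] by (simp add: Compl_partition)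
  then consider "real (card I) \<ge> real CARD('m) / 2" | "real (card (-I)) \<ge> real CARD('m) / 2"
    by linarith
  then show thesis
  proof cases
    case 1
    then show thesis by (rule that(1)) (simp add: I_def)
  next
    case 2
    then show thesis using opp by (rule that(2))
  qed
qed

theorem theorem4p4:
  fixes A :: "real ^ 'n ^ 'm"
    and \<Delta> :: "real ^ 'm \<Rightarrow> real ^ 'n"
    and k :: nat
    and t \<theta>m \<theta>p \<delta> C\<^sub>0 :: real
  assumes "k \<ge> 1"
    and "0 < \<theta>m" "\<theta>m < 1" "1 < \<theta>p" "\<theta>p < 2"
    and "t \<ge> max (2 / \<theta>m) (2 / (2 - \<theta>p))"
    and "srip A (t * real k) \<theta>m \<theta>p"
    and "phaseless_l1_decoder A \<Delta>"
    and "\<delta> = max (1 - \<theta>m) (\<theta>p - 1)"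
    and "C\<^sub>0 = 1 + sqrt ((1 + \<delta>) / ((t - 1) * (1 - \<delta>)))"
  shows "max (2 / \<theta>m) (2 / (2 - \<theta>p)) > 2
       \<and> \<delta> \<le> 1 - 2 / t
       \<and> phaseless_instance_optimal A \<Delta> k (ereal (2 * C\<^sub>0) / ereal (2 - C\<^sub>0))"
proof -
  have "t \<ge> 2 / \<theta>m" "t \<ge> 2 / (2 - \<theta>p)" using assms(6) by auto
  moreover have two: "2 / \<theta>m > 2" using assms(2,3) by (simp add: field_simps)
  ultimately have "t > 2" by linarith
  have "\<theta>m \<ge> 2 / t" "2 - \<theta>p \<ge> 2 / t"
    using \<open>t \<ge> 2 / \<theta>m\<close> \<open>t \<ge> 2 / (2 - \<theta>p)\<close> \<open>t > 2\<close> assms(2,5) by (simp_all add: field_simps)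
  then have \<delta>: "\<delta> \<le> 1 - 2 / t" by (simp add: assms(9))
  have \<delta>\<theta>: "1 - \<delta> \<le> \<theta>m" "\<theta>p \<le> 1 + \<delta>" "1 - \<delta> > 0" "\<delta> > 0" using assms(2-5,9) by auto
  define \<rho> where "\<rho> = sqrt ((1 + \<delta>) / ((t - 1) * (1 - \<delta>)))"
  have "\<rho> \<ge> 0" using \<delta>\<theta> \<open>t > 2\<close> by (simp add: \<rho>_def)
  \<comment> \<open>The hypothesis on \<open>t\<close> enters here:
    \<open>\<delta> \<le> 1 - 2 / t\<close> is equivalent to \<open>\<rho> \<le> 1\<close>, that is,
    to \<open>2 - C\<^sub>0 \<ge> 0\<close>.\<close>
  have "t * \<delta> \<le> t - 2" using \<delta> \<open>t > 2\<close> by (simp add: field_simps)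
  then have "1 + \<delta> \<le> (t - 1) * (1 - \<delta>)" by (simp add: algebra_simps)
  then have "\<rho> \<le> 1" using \<delta>\<theta> \<open>t > 2\<close> by (simp add: \<rho>_def)
  have C: "C\<^sub>0 = 1 + \<rho>" by (simp add: assms(10) \<rho>_def)
  \<comment> \<open>Stated for arbitrary \<open>x\<close> and \<open>y\<close> so that it can be
    applied to the signal and to its negative.\<close>
  have bound: "ereal (l1_norm (y - x)) \<le> ereal (2 * C\<^sub>0) / ereal (2 - C\<^sub>0) * ereal (\<Sum>i\<in>-T. \<bar>x $ i\<bar>)"
    if "l1_norm y \<le> l1_norm x" "real (card I) \<ge> real CARD('m) / 2"
      "\<And>i. i \<in> I \<Longrightarrow> (A *v y) $ i = (A *v x) $ i" "card T \<le> k"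
    for x y :: "real ^ 'n" and I :: "'m set" and T
  proof -
    let ?\<sigma> = "\<Sum>i\<in>-T. \<bar>x $ i\<bar>"
    have "(A *v (y - x)) $ i = 0" if "i \<in> I" for i
      using \<open>i \<in> I \<Longrightarrow> (A *v y) $ i = (A *v x) $ i\<close> that by (simp add: matrix_vector_mult_diff_distrib)
    then have nsp: "(\<Sum>i\<in>T. \<bar>(y - x) $ i\<bar>) < \<rho> * (\<Sum>i\<in>-T. \<bar>(y - x) $ i\<bar>)" if "y \<noteq> x"
      unfolding \<rho>_def
      using that assms(1,7) \<open>t > 2\<close> \<delta>\<theta> \<open>real (card I) \<ge> real CARD('m) / 2\<close> \<open>card T \<le> k\<close>
      by (intro srip_strict_null_space_property[where I = I]) auto
    note err = l1_error_bound[OF that(1) \<open>0 \<le> \<rho>\<close> \<open>\<rho> \<le> 1\<close> nsp]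
    have "?\<sigma> \<ge> 0" by (simp add: sum_nonneg)
    show ?thesis
    \<comment> \<open>Here the constant is \<open>4 / 0 = \<infinity>\<close>. For positive
      \<open>?\<sigma>\<close> the right side is infinite; for \<open>?\<sigma> = 0\<close> it is
      \<open>\<infinity> * 0 = 0\<close>, and exact recovery is required.\<close>
    proof (cases "\<rho> = 1")
      case True
      show ?thesis
      proof (cases "?\<sigma> = 0")
        case True
        then have "y = x" using err(2) by blast
        then show ?thesis using True by (simp add: l1_norm_def)
      next
        case False
        then have "?\<sigma> > 0" using \<open>?\<sigma> \<ge> 0\<close> by linarith
        then show ?thesis using \<open>\<rho> = 1\<close> by (simp add: C divide_ereal_def)
      qed
    next
      case False
      then show ?thesis using err(1) \<open>\<rho> \<le> 1\<close> by (simp add: C field_simps)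
    qed
  qed
  have "phaseless_instance_optimal A \<Delta> k (ereal (2 * C\<^sub>0) / ereal (2 - C\<^sub>0))"
    unfolding phaseless_instance_optimal_def
  proof
    fix x :: "real ^ 'n"
    define y where "y = \<Delta> \<bar>A *v x\<bar>"
    let ?C = "ereal (2 * C\<^sub>0) / ereal (2 - C\<^sub>0)"
    have "is_arg_min l1_norm (\<lambda>z. \<bar>A *v z\<bar> = \<bar>A *v x\<bar>) y"
      using assms(8) by (simp add: phaseless_l1_decoder_def y_def)
    then have Ay: "\<bar>A *v y\<bar> = \<bar>A *v x\<bar>" and le: "l1_norm y \<le> l1_norm x"
      by (auto simp: is_arg_min_linorder)
    obtain z where z: "sparse k z" "best_approx_error k x = l1_norm (x - z)"
      using best_approx_error_attained by blast
    \<comment> \<open>On the complement of the support of a best approximation \<open>z\<close>, the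
      vectors \<open>x\<close> and \<open>x - z\<close> coincide, so the mass of \<open>x\<close>
      there is at most the approximation error.\<close>
    define T where "T = {i. z $ i \<noteq> 0}"
    have T: "card T \<le> k" using z(1) by (simp add: T_def sparse_def)
    have "(\<Sum>i\<in>-T. \<bar>x $ i\<bar>) = (\<Sum>i\<in>-T. \<bar>(x - z) $ i\<bar>)"
      by (intro sum.cong) (auto simp: T_def)
    also have "\<dots> \<le> best_approx_error k x"
      using l1_norm_split[of "x - z" T] by (simp add: z(2) sum_nonneg)
    finally have \<sigma>: "(\<Sum>i\<in>-T. \<bar>x $ i\<bar>) \<le> best_approx_error k x" .
    have "?C \<ge> 0" using \<open>\<rho> \<le> 1\<close> \<open>0 \<le> \<rho>\<close> by (simp add: C)
    then have mono: "?C * ereal (\<Sum>i\<in>-T. \<bar>x $ i\<bar>) \<le> ?C * ereal (best_approx_error k x)"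
      using \<sigma> by (intro ereal_mult_left_mono) auto
    from Ay have "ereal (min (l1_norm (x - y)) (l1_norm (x + y))) \<le> ?C * ereal (\<Sum>i\<in>-T. \<bar>x $ i\<bar>)"
    proof (cases rule: half_agree_or_opposite)
      case (1 I)
      have "l1_norm (x - y) = l1_norm (y - x)" by (simp add: l1_norm_def abs_minus_commute)
      then show ?thesis using bound[OF le 1 T]
        by (metis ereal_less_eq(3) min.cobounded1 order_trans)
    next
      case (2 I)
      \<comment> \<open>Opposite measurements of \<open>x\<close> are equal measurements of
        \<open>- x\<close>, and \<open>y - - x\<close> is the other error
        \<open>x + y\<close>.\<close>
      have "l1_norm y \<le> l1_norm (- x)" using le by (simp add: l1_norm_def)
      moreover have "A *v (- x) = - (A *v x)"
        by (metis matrix_vector_mult_scaleR scaleR_minus1_left)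
      ultimately have "ereal (l1_norm (y - - x)) \<le> ?C * ereal (\<Sum>i\<in>-T. \<bar>(- x) $ i\<bar>)"
        using 2 T by (intro bound[where I = I]) auto
      moreover have "ereal (min (l1_norm (x - y)) (l1_norm (x + y))) \<le> ereal (l1_norm (y - - x))"
        by (simp add: add.commute[of y])
      ultimately show ?thesis by (simp only: vector_uminus_component abs_minus_cancel)
    qed
    with mono show "ereal (min (l1_norm (x - \<Delta> \<bar>A *v x\<bar>)) (l1_norm (x + \<Delta> \<bar>A *v x\<bar>)))
        \<le> ?C * ereal (best_approx_error k x)"
      unfolding y_def by (rule order_trans[rotated])
  qed
  with two \<delta> show ?thesis by auto
qed

end
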